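(* Let $C$ be an extremal even self-dual linear Kleinian code of length $n=6k$. Then for every $w\ge1$ such that $C$ contains a codeword of weight $w$, the set of codewords of $C$ of weight $w$ forms a generalized $2$-$(n,w,\mu)$ design for some $\mu$.
   Context: Let $K=\{0,a,b,c\}$ be the Kleinian four-group. A linear code of length $n$ is a subgroup $C\subseteq K^n$; $\mathrm{wt}(\mathbf{x})$ is the number of nonzero coordinates and the minimal weight $d$ is the least weight of a nonzero codeword. Define $x\cdot y\in\mathbb{F}_2$ for $x,y\in K$ by $x\cdot y=1$ iff $x,y$ are nonzero and distinct; $(\mathbf{x},\mathbf{y})=\sum_ix_i\cdot y_i$; $C^\perp=\{\mathbf{x}:(\mathbf{x},\mathbf{y})=0\ \forall \mathbf{y}\in C\}$; $C$ is self-dual if $C=C^\perp$, even if all codewords have even weight. An even self-dual code of length $n$ is extremal if $d=2\lfloor n/6\rfloor+2$. Let $X_j=\{\mathbf{x}\in K^n:\mathrm{wt}(\mathbf{x})=j\}$. An element $\mathbf{x}\in K^n$ is covered by $\mathbf{y}\in K^n$ if $y_i=x_i$ for every $i$ with $x_i\neq0$. A generalized $t$-$(n,w,\mu)$ design is a nonempty subset $Y\subseteq X_w$ such that every element of $X_t$ is covered by exactly $\mu$ elements of $Y$. *)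

theory Defs
  imports "HOL-Analysis.Analysis" "HOL-Library.Z2"
begin

text \<open>
  The Kleinian four-group, as the product of two copies of the field of two elements, so that
  the componentwise group structure of \<open>K\<^sup>n\<close> (type \<open>klein ^ 'n\<close>, with \<open>n = CARD('n)\<close>) is
  the library instance. The elements \<open>a, b, c\<close> are \<open>(1, 0), (0, 1), (1, 1)\<close>.
\<close>

type_synonym klein = "bit \<times> bit"

definition klein_dot :: "klein \<Rightarrow> klein \<Rightarrow> bit" where
  "klein_dot x y = (if x \<noteq> 0 \<and> y \<noteq> 0 \<and> x \<noteq> y then 1 else 0)"

definition klein_form :: "klein ^ 'n \<Rightarrow> klein ^ 'n \<Rightarrow> bit" where
  "klein_form x y = (\<Sum>i\<in>UNIV. klein_dot (x $ i) (y $ i))"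

definition wt :: "klein ^ 'n \<Rightarrow> nat" where
  "wt x = card {i. x $ i \<noteq> 0}"

definition linear_code :: "(klein ^ 'n) set \<Rightarrow> bool" where
  "linear_code C \<longleftrightarrow> 0 \<in> C \<and> (\<forall>x\<in>C. \<forall>y\<in>C. x + y \<in> C) \<and> (\<forall>x\<in>C. - x \<in> C)"

text \<open>
  The minimum is unspecified for the zero code, which is never self-dual: index types are
  nonempty.
\<close>

definition minimal_weight :: "(klein ^ 'n) set \<Rightarrow> nat" where
  "minimal_weight C = Min (wt ` (C - {0}))"

definition dual_code :: "(klein ^ 'n) set \<Rightarrow> (klein ^ 'n) set" where
  "dual_code C = {x. \<forall>y\<in>C. klein_form x y = 0}"

definition self_dual :: "(klein ^ 'n) set \<Rightarrow> bool" where
  "self_dual C \<longleftrightarrow> C = dual_code C"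

definition even_code :: "(klein ^ 'n) set \<Rightarrow> bool" where
  "even_code C \<longleftrightarrow> (\<forall>x\<in>C. even (wt x))"

definition extremal :: "(klein ^ 'n) set \<Rightarrow> bool" where
  "extremal C \<longleftrightarrow> linear_code C \<and> even_code C \<and> self_dual C \<and>
     minimal_weight C = 2 * (CARD('n) div 6) + 2"

definition weight_shell :: "nat \<Rightarrow> (klein ^ 'n) set" where
  "weight_shell j = {x. wt x = j}"

definition covered_by :: "klein ^ 'n \<Rightarrow> klein ^ 'n \<Rightarrow> bool" where
  "covered_by x y \<longleftrightarrow> (\<forall>i. x $ i \<noteq> 0 \<longrightarrow> y $ i = x $ i)"

text \<open>A generalized \<open>t\<close>-\<open>(n, w, \<mu>)\<close> design, with \<open>n = CARD('n)\<close>.\<close>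

definition generalized_design :: "nat \<Rightarrow> nat \<Rightarrow> nat \<Rightarrow> (klein ^ 'n) set \<Rightarrow> bool" where
  "generalized_design t w \<mu> Y \<longleftrightarrow> Y \<noteq> {} \<and> Y \<subseteq> weight_shell w \<and>
     (\<forall>x\<in>weight_shell t. card {y \<in> Y. covered_by x y} = \<mu>)"

end

theory Submission
  imports Defs "HOL-Computational_Algebra.Polynomial"
begin

text \<open>
  By the MacWilliams identity, the difference of the weight enumerators of two cosets \<open>x + C\<close>
  and \<open>y + C\<close> with \<open>wt x = wt y = 2\<close> is \<open>(1 - t)\<^sup>2\<^sup>k\<^sup>+\<^sup>2\<close> times a binary form of degree
  \<open>2k - 1\<close> in \<open>(1 + 3t)\<^sup>2\<close> and \<open>(1 - t)\<^sup>2\<close>, since the nonzero weights of \<open>C\<close> are even and lie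
  between \<open>2k + 2\<close> and \<open>6k\<close>. The difference is divisible by \<open>t\<^sup>2\<^sup>k\<close>, because \<open>wt (x + c) \<ge> 2k\<close>
  for nonzero codewords \<open>c\<close>; this forces it to vanish. So all vectors of weight 2 have the same
  coset weight distribution, and an induction on the weight extracts from it the number of
  codewords covering a given vector.
\<close>

section \<open>Characters of the Kleinian four-group\<close>

lemma UNIV_bit: "(UNIV :: bit set) = {0, 1}"
  using bit_not_zero_iff by blast

instance bit :: finite
  by standard (simp add: UNIV_bit)

lemma UNIV_klein: "(UNIV :: klein set) = {(0, 0), (0, 1), (1, 0), (1, 1)}"
  by (auto simp: UNIV_Times_UNIV[symmetric] UNIV_bit simp del: UNIV_Times_UNIV)

lemma klein_cases:
  fixes u :: klein
  obtains "u = (0, 0)" | "u = (0, 1)" | "u = (1, 0)" | "u = (1, 1)"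
proof -
  have "u \<in> {(0, 0), (0, 1), (1, 0), (1, 1)}"
    using UNIV_klein by blast
  then show thesis using that by blast
qed

lemma sum_klein:
  fixes f :: "klein \<Rightarrow> 'a :: comm_monoid_add"
  shows "(\<Sum>u\<in>UNIV. f u) = f (0, 0) + f (0, 1) + f (1, 0) + f (1, 1)"
  by (simp add: UNIV_klein add.assoc)

lemma klein_add_eq_0_iff: "(x :: klein) + y = 0 \<longleftrightarrow> y = x"
  by (cases x rule: klein_cases; cases y rule: klein_cases) (auto simp: zero_prod_def)

lemma klein_dot_add_left: "klein_dot (x + y) z = klein_dot x z + klein_dot y z"
  by (cases x rule: klein_cases; cases y rule: klein_cases; cases z rule: klein_cases)
    (simp_all add: klein_dot_def zero_prod_def)

lemma klein_dot_commute: "klein_dot x y = klein_dot y x"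
  by (auto simp: klein_dot_def)

lemma klein_form_add_left: "klein_form (x + y) z = klein_form x z + klein_form y z"
  unfolding klein_form_def vector_add_component klein_dot_add_left sum.distrib ..

lemma klein_form_commute: "klein_form x y = klein_form y x"
  by (simp add: klein_form_def klein_dot_commute)

lemma klein_form_add_right: "klein_form z (x + y) = klein_form z x + klein_form z y"
  by (metis klein_form_add_left klein_form_commute)

text \<open>The nontrivial additive character of \<open>bit\<close>, integer-valued so that
  \<open>of_int\<close> carries it into any commutative ring.\<close>

definition sgn_bit :: "bit \<Rightarrow> int" where
  "sgn_bit b = (if b = 0 then 1 else - 1)"

lemma sgn_bit_add: "sgn_bit (a + b) = sgn_bit a * sgn_bit b"
  by (cases a; cases b) (simp_all add: sgn_bit_def)

lemma sgn_bit_sum: "sgn_bit (sum f A) = (\<Prod>i\<in>A. sgn_bit (f i))"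
proof (induction A rule: infinite_finite_induct)
  case (insert a A)
  then show ?case by (simp add: sgn_bit_add del: add_bit_eq_xor)
qed (simp_all add: sgn_bit_def)

lemma sgn_bit_klein_form:
  "sgn_bit (klein_form x y) = (\<Prod>i\<in>UNIV. sgn_bit (klein_dot (x $ i) (y $ i)))"
  by (simp add: klein_form_def sgn_bit_sum)

text \<open>Fourier transform of the weight on one coordinate: for nonzero \<open>v\<close> the sign
  is 1 at 0 and \<open>v\<close> and -1 at the other two elements, which leaves
  \<open>1 + t - 2 * t\<close>.\<close>

lemma sum_sgn_bit_klein_dot:
  fixes t :: "'a :: comm_ring_1"
  shows "(\<Sum>u\<in>UNIV. of_int (sgn_bit (klein_dot u v)) * (if u \<noteq> 0 then t else 1)) =
    (if v \<noteq> 0 then 1 - t else 1 + 3 * t)"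
  by (cases v rule: klein_cases) (simp_all add: sum_klein klein_dot_def sgn_bit_def zero_prod_def)

lemma power_wt:
  fixes s t :: "'a :: comm_ring_1"
  shows "(\<Prod>i\<in>UNIV. if (x :: klein ^ 'n) $ i \<noteq> 0 then t else s) = s ^ (CARD('n) - wt x) * t ^ wt x"
proof -
  have "card {i. x $ i = 0} = CARD('n) - wt x"
    using card_Diff_subset[of "{i. x $ i \<noteq> 0}" UNIV]
    by (simp add: wt_def Compl_eq_Diff_UNIV[symmetric] Collect_neg_eq)
  then show ?thesis
    by (simp add: prod.If_cases wt_def Collect_neg_eq[symmetric] mult.commute)
qed

section \<open>The MacWilliams identity for cosets of a self-dual code\<close>

lemma sum_vec_prod:
  fixes f :: "'n :: finite \<Rightarrow> 'b :: finite \<Rightarrow> 'a :: comm_semiring_1"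
  shows "(\<Sum>x\<in>(UNIV :: ('b ^ 'n) set). \<Prod>i\<in>UNIV. f i (x $ i)) = (\<Prod>i\<in>UNIV. \<Sum>u\<in>UNIV. f i u)"
proof -
  have "(\<Prod>i\<in>UNIV. \<Sum>u\<in>UNIV. f i u) = (\<Sum>g\<in>UNIV. \<Prod>i\<in>UNIV. f i (g i))"
    by (subst prod_sum_PiE) auto
  also have "\<dots> = (\<Sum>x\<in>(UNIV :: ('b ^ 'n) set). \<Prod>i\<in>UNIV. f i (x $ i))"
    by (rule sum.reindex_bij_witness[of _ vec_nth vec_lambda]) auto
  finally show ?thesis ..
qed

text \<open>The sign and the power of \<open>t\<close> are products over coordinates, so the sum
  factors into one-coordinate transforms.\<close>

lemma sum_sgn_bit_klein_form:
  fixes t :: "'a :: comm_ring_1" and c :: "klein ^ 'n"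
  shows "(\<Sum>y\<in>UNIV. of_int (sgn_bit (klein_form y c)) * t ^ wt y) =
    (1 + 3 * t) ^ (CARD('n) - wt c) * (1 - t) ^ wt c"
proof -
  have "(\<Sum>y\<in>UNIV. of_int (sgn_bit (klein_form y c)) * t ^ wt y) =
      (\<Sum>y\<in>(UNIV :: (klein ^ 'n) set). \<Prod>i\<in>UNIV.
        of_int (sgn_bit (klein_dot (y $ i) (c $ i))) * (if y $ i \<noteq> 0 then t else 1))"
    by (intro sum.cong refl) (simp add: prod.distrib power_wt sgn_bit_klein_form)
  also have "\<dots> = (\<Prod>i\<in>UNIV. \<Sum>u\<in>UNIV.
        of_int (sgn_bit (klein_dot u (c $ i))) * (if u \<noteq> 0 then t else 1))"
    by (rule sum_vec_prod[where f = "\<lambda>i u. of_int (sgn_bit (klein_dot u (c $ i))) * (if u \<noteq> 0 then t else 1)"])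
  also have "\<dots> = (\<Prod>i\<in>UNIV. if c $ i \<noteq> 0 then 1 - t else 1 + 3 * t)"
    unfolding sum_sgn_bit_klein_dot ..
  finally show ?thesis
    by (simp only: power_wt)
qed

text \<open>Orthogonality: translating by a codeword \<open>a\<close> with
  \<open>klein_form x a = 1\<close> permutes \<open>C\<close> and flips every sign, so the sum is
  its own negative.\<close>

lemma sum_sgn_bit_code:
  fixes C :: "(klein ^ 'n) set"
  assumes "linear_code C"
  shows "(\<Sum>c\<in>C. sgn_bit (klein_form x c)) = (if x \<in> dual_code C then int (card C) else 0)"
proof (cases "x \<in> dual_code C")
  case True
  then show ?thesis by (simp add: dual_code_def sgn_bit_def)
next
  case False
  then obtain a where a: "a \<in> C" "klein_form x a = 1"
    using bit_not_zero_iff by (auto simp: dual_code_def)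
  have aa: "a + (a + c) = c" for c
  proof -
    have "a + a = 0"
      by (simp add: vec_eq_iff klein_add_eq_0_iff)
    then show ?thesis by (simp flip: add.assoc)
  qed
  have "(\<Sum>c\<in>C. sgn_bit (klein_form x c)) = (\<Sum>c\<in>C. sgn_bit (klein_form x (a + c)))"
    by (rule sum.reindex_bij_witness[of _ "\<lambda>c. a + c" "\<lambda>c. a + c"])
      (use a assms in \<open>auto simp: linear_code_def aa\<close>)
  also have "\<dots> = - (\<Sum>c\<in>C. sgn_bit (klein_form x c))"
    using a(2) by (simp add: klein_form_add_right sgn_bit_add sum_negf sgn_bit_def[of 1] del: add_bit_eq_xor)
  finally show ?thesis using False by simp
qed

text \<open>After exchanging sums, orthogonality keeps exactly the \<open>y\<close> in the coset of
  \<open>x\<close>, as the dual code is \<open>C\<close>. Since \<open>t\<close> is any ring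
  element, the polynomial indeterminate can be inserted later.\<close>

lemma coset_macwilliams:
  fixes t :: "'a :: comm_ring_1" and C :: "(klein ^ 'n) set"
  assumes "linear_code C" "self_dual C"
  shows "of_nat (card C) * (\<Sum>c\<in>C. t ^ wt (x + c)) =
    (\<Sum>c\<in>C. of_int (sgn_bit (klein_form x c)) * ((1 + 3 * t) ^ (CARD('n) - wt c) * (1 - t) ^ wt c))"
proof -
  have xx: "x + (x + y) = y" for y
  proof -
    have "x + x = 0"
      by (simp add: vec_eq_iff klein_add_eq_0_iff)
    then show ?thesis by (simp flip: add.assoc)
  qed
  have dual: "dual_code C = C" using assms by (simp add: self_dual_def)
  have "(\<Sum>c\<in>C. of_int (sgn_bit (klein_form x c)) * ((1 + 3 * t) ^ (CARD('n) - wt c) * (1 - t) ^ wt c))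
      = (\<Sum>c\<in>C. \<Sum>y\<in>UNIV. of_int (sgn_bit (klein_form (x + y) c)) * t ^ wt y)"
    by (simp add: sum_sgn_bit_klein_form[symmetric] sum_distrib_left klein_form_add_left sgn_bit_add
        mult.assoc del: add_bit_eq_xor)
  also have "\<dots> = (\<Sum>y\<in>UNIV. of_int (\<Sum>c\<in>C. sgn_bit (klein_form (x + y) c)) * t ^ wt y)"
    by (subst sum.swap) (simp add: sum_distrib_right)
  also have "\<dots> = (\<Sum>y\<in>UNIV. if x + y \<in> C then of_nat (card C) * t ^ wt y else 0)"
    by (intro sum.cong refl) (simp add: sum_sgn_bit_code[OF assms(1)] dual)
  also have "\<dots> = (\<Sum>y\<in>{y. x + y \<in> C}. of_nat (card C) * t ^ wt y)"
    by (simp add: sum.If_cases)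
  also have "\<dots> = (\<Sum>c\<in>C. of_nat (card C) * t ^ wt (x + c))"
    by (rule sum.reindex_bij_witness[of _ "\<lambda>c. x + c" "\<lambda>c. x + c"]) (auto simp: xx)
  finally show ?thesis by (simp add: sum_distrib_left)
qed

section \<open>Binary forms vanishing to high order\<close>

text \<open>Abel summation: the form minus its coefficient sum times \<open>Q ^ m\<close> vanishes
  at \<open>P = Q\<close>, so \<open>Q - P\<close> splits off, leaving the negated partial sums of
  \<open>e\<close> as coefficients.\<close>

lemma sum_by_parts_form:
  fixes e :: "nat \<Rightarrow> int" and P Q :: "'a :: comm_ring_1"
  shows "(\<Sum>i\<le>m. of_int (e i) * (P ^ (m - i) * Q ^ i)) =
    (Q - P) * (\<Sum>i<m. of_int (- (\<Sum>j\<le>i. e j)) * (P ^ (m - 1 - i) * Q ^ i)) +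
    of_int (\<Sum>i\<le>m. e i) * Q ^ m"
proof (induction m)
  case 0
  then show ?case by simp
next
  case (Suc m)
  let ?f = "\<lambda>i. - (\<Sum>j\<le>i. e j)"
  have A: "(\<Sum>i\<le>Suc m. of_int (e i) * (P ^ (Suc m - i) * Q ^ i)) =
      P * (\<Sum>i\<le>m. of_int (e i) * (P ^ (m - i) * Q ^ i)) + of_int (e (Suc m)) * Q ^ Suc m"
    by (auto simp: sum_distrib_left Suc_diff_le intro!: sum.cong)
  have B: "(\<Sum>i<Suc m. of_int (?f i) * (P ^ (Suc m - 1 - i) * Q ^ i)) =
      P * (\<Sum>i<m. of_int (?f i) * (P ^ (m - 1 - i) * Q ^ i)) + of_int (?f m) * Q ^ m"
  proof -
    have "P ^ (m - i) = P * P ^ (m - 1 - i)" if "i < m" for i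
      using that by (simp flip: power_Suc add: Suc_diff_Suc)
    then show ?thesis
      by (auto simp: sum_distrib_left intro!: sum.cong)
  qed
  show ?case
    unfolding A B Suc.IH by (simp add: algebra_simps)
qed

text \<open>
  A binary form of degree \<open>m\<close> in \<open>P\<close> and \<open>Q\<close> corresponds to a polynomial of degree at most \<open>m\<close>
  in \<open>Q / P\<close>; as \<open>Q / P - 1\<close> vanishes to order exactly one at the origin, a zero of order
  \<open>m + 1\<close> there forces all coefficients to vanish.
\<close>

lemma binary_form_eq_0:
  fixes e :: "nat \<Rightarrow> int" and P Q R G :: "int poly"
  assumes "[:0, 1:] ^ Suc m dvd G * (\<Sum>i\<le>m. of_int (e i) * (P ^ (m - i) * Q ^ i))"
    and "Q - P = [:0, 1:] * R" and "poly Q 0 \<noteq> 0" and "poly R 0 \<noteq> 0" and "poly G 0 \<noteq> 0"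
    and "i \<le> m"
  shows "e i = 0"
  using assms
proof (induction m arbitrary: G e i)
  case 0
  then have "poly (G * of_int (e 0)) 0 = 0"
    using poly_eq_0_iff_dvd[of "G * of_int (e 0)" 0] by simp
  then show ?case using 0 by simp
next
  case (Suc m)
  let ?S = "\<Sum>i\<le>Suc m. of_int (e i) * (P ^ (Suc m - i) * Q ^ i)"
  let ?f = "\<lambda>i. - (\<Sum>j\<le>i. e j)"
  let ?F = "\<Sum>i\<le>m. of_int (?f i) * (P ^ (m - i) * Q ^ i)"
  have S: "?S = [:0, 1:] * R * ?F + of_int (\<Sum>i\<le>Suc m. e i) * Q ^ Suc m"
    unfolding sum_by_parts_form[of e P "Suc m" Q] Suc.prems(2)
    by (simp only: lessThan_Suc_atMost diff_Suc_1)
  have "[:0, 1:] dvd G * ?S"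
    using Suc.prems(1) by (rule dvd_trans[rotated]) (simp only: power_Suc dvd_triv_left)
  then have "poly (G * ?S) 0 = 0"
    using poly_eq_0_iff_dvd[of "G * ?S" 0] by simp
  \<comment> \<open>At the origin the first summand of \<open>S\<close> vanishes while
    \<open>G\<close> and \<open>Q\<close> do not.\<close>
  then have z: "(\<Sum>i\<le>Suc m. e i) = 0"
    unfolding S using Suc.prems by (simp del: of_int_sum sum.atMost_Suc)
  have "[:0, 1:] * [:0, 1:] ^ Suc m dvd [:0, 1:] * (G * R * ?F)"
    using Suc.prems(1) unfolding S z by (simp only: power_Suc ac_simps of_int_0 mult_zero_left add_0_right add_0_left)
  then have "[:0, 1:] ^ Suc m dvd G * R * ?F"
    by (subst (asm) dvd_mult_cancel_left) simp
  \<comment> \<open>The cofactor \<open>G\<close> absorbs \<open>R\<close> at each descent in the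
    degree.\<close>
  then have f: "?f i = 0" if "i \<le> m" for i
    using Suc.IH[of "G * R" ?f i] Suc.prems that by simp
  \<comment> \<open>All partial sums vanish, the last by \<open>z\<close>, and \<open>e i\<close> is
    a difference of consecutive ones.\<close>
  show ?case
  proof (cases i)
    case 0
    then show ?thesis using f[of 0] by simp
  next
    case (Suc j)
    have "(\<Sum>l\<le>i. e l) = 0"
      using f[of i] z Suc.prems(6) by (cases "i = Suc m") auto
    then show ?thesis
      using f[of j] Suc Suc.prems(6) by simp
  qed
qed

section \<open>Weights and pairs of coordinates\<close>

lemma wt_eq_sum: "wt x = (\<Sum>i\<in>UNIV. of_bool (x $ i \<noteq> 0))"
  by (simp add: wt_def)

lemma weight_2_obtain:
  assumes "x \<in> weight_shell 2"
  obtains i j where "i \<noteq> j" "x $ i \<noteq> 0" "x $ j \<noteq> 0" "\<And>l. l \<noteq> i \<Longrightarrow> l \<noteq> j \<Longrightarrow> x $ l = 0"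
proof -
  from assms obtain i j where "{i. x $ i \<noteq> 0} = {i, j}" "i \<noteq> j"
    by (auto simp: weight_shell_def wt_def card_2_iff)
  then show thesis
    by (intro that[of i j]) blast+
qed

text \<open>Only the coordinates \<open>i\<close> and \<open>j\<close> can change, and there
  \<open>x + c\<close> is zero exactly where \<open>c\<close> agrees with \<open>x\<close>.
  Correction terms on both sides avoid subtraction in \<open>nat\<close>.\<close>

lemma wt_add_weight_2:
  fixes x c :: "klein ^ 'n"
  assumes "i \<noteq> j" "\<And>l. l \<noteq> i \<Longrightarrow> l \<noteq> j \<Longrightarrow> x $ l = 0"
  shows "wt (x + c) + of_bool (c $ i \<noteq> 0) + of_bool (c $ j \<noteq> 0) =
    wt c + of_bool (c $ i \<noteq> x $ i) + of_bool (c $ j \<noteq> x $ j)"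
proof -
  have split: "wt y = of_bool (y $ i \<noteq> 0) + of_bool (y $ j \<noteq> 0) +
      (\<Sum>l\<in>UNIV - {i} - {j}. of_bool (y $ l \<noteq> 0))" for y :: "klein ^ 'n"
    unfolding wt_eq_sum using assms(1)
    by (subst sum.remove[of _ i], simp, simp, subst sum.remove[of _ j]) simp_all
  have "(\<Sum>l\<in>UNIV - {i} - {j}. of_bool ((x + c) $ l \<noteq> 0)) =
      (\<Sum>l\<in>UNIV - {i} - {j}. of_bool (c $ l \<noteq> 0) :: nat)"
    using assms(2) by (intro sum.cong) auto
  then show ?thesis
    unfolding split[of "x + c"] split[of c] by (simp add: klein_add_eq_0_iff)
qed

text \<open>Adding \<open>x\<close> can cancel at most two entries of \<open>c\<close>, and cancels
  two only if \<open>c\<close> agrees with \<open>x\<close> on its support.\<close>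

lemma weight_2_distance:
  fixes x c :: "klein ^ 'n"
  assumes "x \<in> weight_shell 2"
  shows "wt c \<le> wt (x + c) + 2" and "wt c = wt (x + c) + 2 \<longleftrightarrow> covered_by x c"
proof -
  obtain i j where ij: "i \<noteq> j" "x $ i \<noteq> 0" "x $ j \<noteq> 0" "\<And>l. l \<noteq> i \<Longrightarrow> l \<noteq> j \<Longrightarrow> x $ l = 0"
    using weight_2_obtain[OF assms] by metis
  have cov: "covered_by x c \<longleftrightarrow> c $ i = x $ i \<and> c $ j = x $ j"
    using ij by (metis covered_by_def)
  show "wt c \<le> wt (x + c) + 2" "wt c = wt (x + c) + 2 \<longleftrightarrow> covered_by x c"
    using wt_add_weight_2[OF ij(1,4), of c] ij(2,3) unfolding cov of_bool_def
    by (auto split: if_splits)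
qed

section \<open>Counting words of a design by their entries at two coordinates\<close>

lemma card_split_coordinate:
  fixes Y :: "(klein ^ 'n) set"
  shows "card {y \<in> Y. P y} = (\<Sum>u\<in>UNIV. card {y \<in> Y. P y \<and> y $ i = u})"
proof -
  have "{y \<in> Y. P y} = (\<Union>u. {y \<in> Y. P y \<and> y $ i = u})" by auto
  then show ?thesis
    by (simp only:) (subst card_UN_disjoint; auto)
qed

text \<open>The design property counts pairs of nonzero entries, double counting gives the counts
  for a single nonzero entry, and subtraction yields those involving zeros.\<close>

lemma design_pair_counts:
  fixes Y :: "(klein ^ 'n) set"
  assumes Y: "Y \<subseteq> weight_shell w" and "w \<noteq> 1"
    and cov: "\<forall>x\<in>weight_shell 2. card {y \<in> Y. covered_by x y} = \<mu>"
  obtains m where "\<And>i j u v. i \<noteq> j \<Longrightarrow> card {y \<in> Y. y $ i = u \<and> y $ j = v} = m (u \<noteq> 0) (v \<noteq> 0)"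
proof -
  define N where "N i u j v = card {y \<in> Y. y $ i = u \<and> y $ j = v}" for i j u v
  define L where "L i u = card {y \<in> Y. y $ i = u}" for i u
  \<comment> \<open>The number of words with a prescribed nonzero entry at one coordinate. For
    \<open>w = 0\<close> the division by 0 yields 0, which is the right count.\<close>
  define l where "l = 3 * (CARD('n) - 1) * \<mu> div (w - 1)"
  have N_nonzero: "N i u j v = \<mu>" if "i \<noteq> j" "u \<noteq> 0" "v \<noteq> 0" for i j u v
  proof -
    define x :: "klein ^ 'n" where "x = (\<chi> l. if l = i then u else if l = j then v else 0)"
    have "{l. x $ l \<noteq> 0} = {i, j}"
      using that by (auto simp: x_def)
    then have "x \<in> weight_shell 2"
      using that by (simp add: weight_shell_def wt_def)
    moreover have "covered_by x y \<longleftrightarrow> y $ i = u \<and> y $ j = v" for y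
      using that by (auto simp: covered_by_def x_def)
    ultimately show ?thesis
      using cov[rule_format, of x] by (simp add: N_def)
  qed
  have N_commute: "N i u j v = N j v i u" for i j u v
    unfolding N_def by (rule arg_cong[where f = card]) auto
  have L_eq: "L i u = N i u j (0, 0) + N i u j (0, 1) + N i u j (1, 0) + N i u j (1, 1)" for i j u
    unfolding L_def N_def using card_split_coordinate[of Y "\<lambda>y. y $ i = u" j] by (simp add: sum_klein)
  have L_nonzero: "L i u = l" if "u \<noteq> 0" for i u
  proof -
    let ?Z = "{y \<in> Y. y $ i = u}"
    \<comment> \<open>Double counting of nonzero entries: coordinate \<open>i\<close> contributes 1
      for each word, every other coordinate \<open>3 * \<mu>\<close> in total.\<close>
    have "L i u * w = (\<Sum>y\<in>?Z. wt y)"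
      using Y by (auto simp: L_def weight_shell_def subset_iff intro!: sum.cong)
    also have "\<dots> = (\<Sum>y\<in>?Z. 1 + (\<Sum>j\<in>UNIV - {i}. of_bool (y $ j \<noteq> 0)))"
      unfolding wt_eq_sum using that
      by (intro sum.cong refl) (subst sum.remove[of _ i], simp_all)
    also have "\<dots> = L i u + (\<Sum>j\<in>UNIV - {i}. \<Sum>y\<in>?Z. of_bool (y $ j \<noteq> 0))"
      by (subst sum.distrib, subst sum.swap) (simp add: L_def)
    also have "(\<Sum>j\<in>UNIV - {i}. \<Sum>y\<in>?Z. of_bool (y $ j \<noteq> 0)) = (\<Sum>j\<in>UNIV - {i}. 3 * \<mu>)"
    proof (intro sum.cong refl)
      fix j assume j: "j \<in> UNIV - {i}"
      have "(\<Sum>y\<in>?Z. of_bool (y $ j \<noteq> 0)) = card {y \<in> Y. y $ i = u \<and> y $ j \<noteq> 0}"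
        by (simp add: Collect_conj_eq Int_assoc)
      also have "\<dots> = (\<Sum>v\<in>UNIV. card {y \<in> Y. (y $ i = u \<and> y $ j \<noteq> 0) \<and> y $ j = v})"
        by (rule card_split_coordinate)
      also have "\<dots> = (\<Sum>v\<in>UNIV. if v \<noteq> 0 then N i u j v else 0)"
        unfolding N_def by (auto intro!: sum.cong arg_cong[where f = card])
      also have "\<dots> = 3 * \<mu>"
        using N_nonzero[of i j u] j that by (simp add: sum_klein zero_prod_def)
      finally show "(\<Sum>y\<in>?Z. of_bool (y $ j \<noteq> 0)) = 3 * \<mu>" .
    qed
    finally have eq: "L i u * w = L i u + 3 * (CARD('n) - 1) * \<mu>"
      by simp
    then have eq1: "L i u * (w - 1) = 3 * (CARD('n) - 1) * \<mu>"
      by (simp add: diff_mult_distrib2)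
    moreover have "L i u = 0" if "w = 0"
      using eq that by simp
    ultimately show ?thesis
      using \<open>w \<noteq> 1\<close> by (cases "w = 0") (simp_all add: l_def eq1[symmetric] del: One_nat_def)
  qed
  \<comment> \<open>The truncated subtractions here and in \<open>N_zero\<close> are exact: each
    rearranges a sum that partitions words by one entry.\<close>
  have N_half: "N i u j 0 = l - 3 * \<mu>" if "i \<noteq> j" "u \<noteq> 0" for i j u
    using L_eq[of i u j] L_nonzero[of u i] N_nonzero[OF that] that(2) by (simp add: zero_prod_def)
  have N_zero: "N i 0 j 0 = card Y - 3 * l - 3 * (l - 3 * \<mu>)" if "i \<noteq> j" for i j
  proof -
    have "card Y = L i (0, 0) + L i (0, 1) + L i (1, 0) + L i (1, 1)"
      using card_split_coordinate[of Y "\<lambda>_. True" i] by (simp add: sum_klein L_def)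
    then have "card Y = L i 0 + 3 * l"
      by (simp add: L_nonzero zero_prod_def)
    moreover have "N i 0 j v = l - 3 * \<mu>" if "v \<noteq> 0" for v
      using N_half[of j i v] N_commute[of i 0 j v] that \<open>i \<noteq> j\<close> by simp
    ultimately show ?thesis
      using L_eq[of i 0 j] by (simp add: zero_prod_def)
  qed
  define m where "m p q = (if p \<and> q then \<mu> else if p \<or> q then l - 3 * \<mu>
    else card Y - 3 * l - 3 * (l - 3 * \<mu>))" for p q
  have "N i u j v = m (u \<noteq> 0) (v \<noteq> 0)" if "i \<noteq> j" for i j u v
    using N_nonzero[OF that, of u v] N_half[OF that, of u] N_half[OF that[symmetric], of v]
      N_zero[OF that] N_commute[of i u j v] by (cases "u = 0"; cases "v = 0") (simp_all add: m_def)
  then show thesis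
    using that unfolding N_def by blast
qed

text \<open>The weight of \<open>x + y\<close> depends only on \<open>w\<close> and on the entries
  of \<open>y\<close> on the support of \<open>x\<close>, whose joint counts
  \<open>design_pair_counts\<close> supplies.\<close>

lemma design_distance_counts:
  fixes Y :: "(klein ^ 'n) set"
  assumes Y: "Y \<subseteq> weight_shell w" and "w \<noteq> 1"
    and "\<forall>x\<in>weight_shell 2. card {y \<in> Y. covered_by x y} = \<mu>"
  shows "\<exists>\<kappa>. \<forall>x\<in>weight_shell 2. card {y \<in> Y. wt (x + y) = d} = \<kappa>"
proof -
  obtain m where m: "\<And>i j u v. i \<noteq> j \<Longrightarrow>
      card {y \<in> Y. y $ i = u \<and> y $ j = v} = m (u \<noteq> 0) (v \<noteq> 0)"
    using design_pair_counts[OF assms] by blast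
  \<comment> \<open>\<open>p\<close> and \<open>q\<close> record disagreement with \<open>x\<close>,
    \<open>p0\<close> and \<open>q0\<close> being nonzero.\<close>
  define h where "h p q p0 q0 =
    (if w + of_bool p + of_bool q = d + of_bool p0 + of_bool q0 then m p0 q0 else 0)" for p q p0 q0
  define G where "G a b = (\<Sum>u\<in>UNIV. \<Sum>v\<in>UNIV. h (u \<noteq> a) (v \<noteq> b) (u \<noteq> 0) (v \<noteq> 0))"
    for a b :: klein
  have "card {y \<in> Y. wt (x + y) = d} = G (0, 1) (0, 1)" if x: "x \<in> weight_shell 2" for x
  proof -
    obtain i j where ij: "i \<noteq> j" "x $ i \<noteq> 0" "x $ j \<noteq> 0" "\<And>l. l \<noteq> i \<Longrightarrow> l \<noteq> j \<Longrightarrow> x $ l = 0"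
      using weight_2_obtain[OF x] by metis
    have "card {y \<in> Y. wt (x + y) = d} =
        (\<Sum>u\<in>UNIV. \<Sum>v\<in>UNIV. card {y \<in> Y. (wt (x + y) = d \<and> y $ i = u) \<and> y $ j = v})"
      by (subst card_split_coordinate[of _ _ i], subst card_split_coordinate[of _ _ j]) (rule refl)
    also have "\<dots> = G (x $ i) (x $ j)"
      unfolding G_def
    proof (intro sum.cong refl)
      fix u v :: klein
      define E where "E \<longleftrightarrow> w + of_bool (u \<noteq> x $ i) + of_bool (v \<noteq> x $ j) = d + of_bool (u \<noteq> 0) + of_bool (v \<noteq> 0)"
      have "wt (x + y) = d \<longleftrightarrow> E" if "y \<in> Y" "y $ i = u" "y $ j = v" for y
        using wt_add_weight_2[OF ij(1,4), of y] that Y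
        by (auto simp: E_def weight_shell_def subset_iff)
      then have "{y \<in> Y. (wt (x + y) = d \<and> y $ i = u) \<and> y $ j = v} =
          (if E then {y \<in> Y. y $ i = u \<and> y $ j = v} else {})"
        by auto
      then have "card {y \<in> Y. (wt (x + y) = d \<and> y $ i = u) \<and> y $ j = v} =
          (if E then m (u \<noteq> 0) (v \<noteq> 0) else 0)"
        using m[OF ij(1), of u v] by simp
      then show "card {y \<in> Y. (wt (x + y) = d \<and> y $ i = u) \<and> y $ j = v} =
          h (u \<noteq> x $ i) (v \<noteq> x $ j) (u \<noteq> 0) (v \<noteq> 0)"
        unfolding h_def E_def .
    qed
    \<comment> \<open>Permuting the nonzero group elements only permutes the summands of
      \<open>G\<close>, so \<open>(0, 1)\<close> represents any nonzero entry.\<close>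
    also have "\<dots> = G (0, 1) (0, 1)"
      using ij(2,3)
      by (cases "x $ i" rule: klein_cases; cases "x $ j" rule: klein_cases)
        (simp_all add: G_def sum_klein zero_prod_def)
    finally show ?thesis .
  qed
  then show ?thesis by blast
qed

text \<open>
  A word \<open>c\<close> of weight \<open>w\<close> covers \<open>x\<close> iff \<open>x + c\<close> has weight \<open>w - 2\<close>. The other words
  \<open>c\<close> with \<open>wt (x + c) = w - 2\<close> have smaller weight; the induction hypothesis makes their
  number independent of \<open>x\<close>.
\<close>

lemma shells_cover_regularly:
  fixes C :: "(klein ^ 'n) set"
  assumes one: "\<forall>c\<in>C. wt c \<noteq> 1"
    and coset: "\<And>d. \<exists>\<kappa>. \<forall>x\<in>weight_shell 2. card {c \<in> C. wt (x + c) = d} = \<kappa>"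
  shows "\<exists>\<mu>. \<forall>x\<in>weight_shell 2. card {c \<in> {c \<in> C. wt c = w}. covered_by x c} = \<mu>"
proof (induction w rule: less_induct)
  case (less w)
  show ?case
  proof (cases "w < 2")
    case True
    have "card {c \<in> {c \<in> C. wt c = w}. covered_by x c} = 0" if "x \<in> weight_shell 2" for x
    proof -
      have "\<not> covered_by x c" if "wt c = w" for c
        using weight_2_distance(2)[OF \<open>x \<in> _\<close>, of c] that True by auto
      then have "{c \<in> {c \<in> C. wt c = w}. covered_by x c} = {}" by auto
      then show ?thesis by (simp only: card.empty)
    qed
    then show ?thesis by blast
  next
    case False
    have "\<exists>\<kappa>. \<forall>x\<in>weight_shell 2. card {c \<in> {c \<in> C. wt c = v}. wt (x + c) = w - 2} = \<kappa>"
      if v: "v < w" for v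
    \<comment> \<open>Weight 1 is outside the reach of the double counting, which divides by
      \<open>v - 1\<close>, but no codeword has it.\<close>
    proof (cases "v = 1")
      case True
      then have "{c \<in> C. wt c = v} = {}" using one by auto
      then show ?thesis by (simp only: empty_iff) simp
    next
      case False
      obtain \<mu> where "\<forall>x\<in>weight_shell 2. card {c \<in> {c \<in> C. wt c = v}. covered_by x c} = \<mu>"
        using less.IH[OF v] by blast
      then show ?thesis
        using False by (intro design_distance_counts) (auto simp: weight_shell_def)
    qed
    then have "\<exists>\<kappa>. \<forall>v\<in>{..<w}. \<forall>x\<in>weight_shell 2.
        card {c \<in> {c \<in> C. wt c = v}. wt (x + c) = w - 2} = \<kappa> v"
      by (intro bchoice) simp
    then obtain \<kappa> where \<kappa>: "\<And>v x. v < w \<Longrightarrow> x \<in> weight_shell 2 \<Longrightarrow>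
        card {c \<in> {c \<in> C. wt c = v}. wt (x + c) = w - 2} = \<kappa> v"
      by blast
    obtain \<beta> where \<beta>: "\<And>x. x \<in> weight_shell 2 \<Longrightarrow> card {c \<in> C. wt (x + c) = w - 2} = \<beta>"
      using coset by blast
    have "card {c \<in> {c \<in> C. wt c = w}. covered_by x c} = \<beta> - (\<Sum>v<w. \<kappa> v)"
      if x: "x \<in> weight_shell 2" for x
    proof -
      let ?A = "{c \<in> {c \<in> C. wt c = w}. covered_by x c}"
      let ?B = "\<lambda>v. {c \<in> {c \<in> C. wt c = v}. wt (x + c) = w - 2}"
      have "c \<in> ?A \<longleftrightarrow> c \<in> C \<and> wt c = w \<and> wt (x + c) = w - 2" for c
        using weight_2_distance(2)[OF x, of c] False by auto
      moreover have "wt c \<le> w" if "wt (x + c) = w - 2" for c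
        using weight_2_distance(1)[OF x, of c] that False by simp
      ultimately have "{c \<in> C. wt (x + c) = w - 2} = ?A \<union> (\<Union>v\<in>{..<w}. ?B v)"
        by (auto simp: le_less)
      then have "\<beta> = card (?A \<union> (\<Union>v\<in>{..<w}. ?B v))"
        using \<beta>[OF x] by simp
      also have "\<dots> = card ?A + card (\<Union>v\<in>{..<w}. ?B v)"
        by (rule card_Un_disjoint) auto
      also have "card (\<Union>v\<in>{..<w}. ?B v) = (\<Sum>v<w. card (?B v))"
        by (rule card_UN_disjoint) auto
      also have "\<dots> = (\<Sum>v<w. \<kappa> v)"
        using \<kappa> x by simp
      finally show ?thesis by simp
    qed
    then show ?thesis by blast
  qed
qed

section \<open>Coset weight distributions of extremal codes\<close>

lemma coeff_sum_powers:
  assumes "finite A"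
  shows "coeff (\<Sum>c\<in>A. [:0, 1:] ^ f c :: int poly) d = int (card {c \<in> A. f c = d})"
proof -
  have "[:0, 1 :: int:] ^ j = monom 1 j" for j
    by (simp add: monom_altdef)
  then show ?thesis
    using assms by (simp add: coeff_sum sum.If_cases Int_def)
qed

text \<open>There are \<open>m + 1 = 2 * k\<close> unknown coefficients, exactly the order to which
  the difference vanishes at the origin, as \<open>binary_form_eq_0\<close> requires.\<close>

lemma coset_distribution_weight_2:
  fixes C :: "(klein ^ 'n) set"
  assumes n: "CARD('n) = 6 * k" and "linear_code C" "even_code C" "self_dual C"
    and min: "\<And>c. c \<in> C \<Longrightarrow> c \<noteq> 0 \<Longrightarrow> 2 * k + 2 \<le> wt c"
    and x: "x \<in> weight_shell 2" and y: "y \<in> weight_shell 2"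
  shows "card {c \<in> C. wt (x + c) = d} = card {c \<in> C. wt (y + c) = d}"
proof -
  define T :: "int poly" where "T = [:0, 1:]"
  define P where "P = (1 + 3 * T)\<^sup>2"
  define Q where "Q = (1 - T)\<^sup>2"
  \<comment> \<open>The possible even weights from \<open>2 * k + 2\<close> to \<open>6 * k\<close>
    are numbered by \<open>ix\<close> from 0 to \<open>m\<close>.\<close>
  define m where "m = 2 * k - 1"
  define s where "s c = sgn_bit (klein_form x c) - sgn_bit (klein_form y c)" for c
  define ix where "ix c = (wt c - (2 * k + 2)) div 2" for c :: "klein ^ 'n"
  define E where "E i = (\<Sum>c\<in>{c \<in> C - {0}. ix c = i}. s c)" for i
  define D where "D = (\<Sum>c\<in>C. T ^ wt (x + c)) - (\<Sum>c\<in>C. T ^ wt (y + c))"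
  have "k > 0" using n by (cases k) auto
  then have Suc_m: "Suc m = 2 * k" by (simp add: m_def)
  have "0 \<in> C" using assms(2) by (simp add: linear_code_def)
  \<comment> \<open>This removes the zero codeword, whose term lacks the factor
    \<open>(1 - T) ^ (2 * k + 2)\<close>.\<close>
  have "s 0 = 0"
    by (simp add: s_def klein_form_def klein_dot_def)
  have wt_le: "wt c \<le> 6 * k" for c :: "klein ^ 'n"
    unfolding wt_def n[symmetric] by (rule card_mono) auto
  have ix: "ix c \<le> m \<and> wt c = 2 * k + 2 + 2 * ix c" if "c \<in> C - {0}" for c
  proof -
    have "even (wt c)" "2 * k + 2 \<le> wt c"
      using that min assms(3) by (auto simp: even_code_def)
    then obtain r where "wt c = 2 * k + 2 + 2 * r"
      by (metis dvd_def even_diff_nat le_add_diff_inverse even_add even_numeral)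
    then show ?thesis
      using wt_le[of c] \<open>k > 0\<close> by (simp add: ix_def m_def)
  qed
  have term_eq: "(1 + 3 * T) ^ (CARD('n) - wt c) * (1 - T) ^ wt c =
      (1 - T) ^ (2 * k + 2) * (P ^ (m - ix c) * Q ^ ix c)" if "c \<in> C - {0}" for c
  proof -
    have "CARD('n) - wt c = 2 * (m - ix c)"
      using ix[OF that] n \<open>k > 0\<close> by (simp add: m_def)
    then show ?thesis
      using ix[OF that] by (simp add: P_def Q_def power_mult[symmetric] power_add)
  qed
  have "of_nat (card C) * D = (\<Sum>c\<in>C. of_int (s c) * ((1 + 3 * T) ^ (CARD('n) - wt c) * (1 - T) ^ wt c))"
    unfolding D_def right_diff_distrib coset_macwilliams[OF assms(2,4)]
    by (simp add: s_def left_diff_distrib sum_subtractf)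
  also have "\<dots> = (\<Sum>c\<in>C - {0}. of_int (s c) * ((1 + 3 * T) ^ (CARD('n) - wt c) * (1 - T) ^ wt c))"
    using \<open>0 \<in> C\<close> \<open>s 0 = 0\<close> by (subst sum.remove[of _ 0]) simp_all
  also have "\<dots> = (\<Sum>c\<in>C - {0}. (1 - T) ^ (2 * k + 2) * (of_int (s c) * (P ^ (m - ix c) * Q ^ ix c)))"
    by (intro sum.cong refl) (subst term_eq, assumption, rule mult.left_commute)
  also have "\<dots> = (1 - T) ^ (2 * k + 2) * (\<Sum>c\<in>C - {0}. of_int (s c) * (P ^ (m - ix c) * Q ^ ix c))"
    by (simp only: sum_distrib_left)
  also have "(\<Sum>c\<in>C - {0}. of_int (s c) * (P ^ (m - ix c) * Q ^ ix c)) =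
      (\<Sum>i\<le>m. \<Sum>c\<in>{c \<in> C - {0}. ix c = i}. of_int (s c) * (P ^ (m - ix c) * Q ^ ix c))"
    by (rule sum.group[symmetric]) (use ix in auto)
  also have "\<dots> = (\<Sum>i\<le>m. of_int (E i) * (P ^ (m - i) * Q ^ i))"
    by (intro sum.cong refl) (simp add: E_def sum_distrib_right)
  finally have D: "of_nat (card C) * D =
      (1 - T) ^ (2 * k + 2) * (\<Sum>i\<le>m. of_int (E i) * (P ^ (m - i) * Q ^ i))" .
  \<comment> \<open>For nonzero \<open>c\<close> both exponents are at least \<open>2 * k\<close>;
    for \<open>c = 0\<close> the two terms cancel.\<close>
  have "T ^ Suc m dvd D"
    unfolding D_def sum_subtractf[symmetric]
  proof (rule dvd_sum)
    fix c assume "c \<in> C"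
    have "wt x = wt y" using x y by (simp add: weight_shell_def)
    moreover have "T ^ Suc m dvd T ^ wt (z + c)" if "c \<noteq> 0" "z \<in> weight_shell 2" for z
      using min[OF \<open>c \<in> C\<close> that(1)] weight_2_distance(1)[OF that(2), of c]
      by (intro le_imp_power_dvd) (simp add: Suc_m)
    ultimately show "T ^ Suc m dvd T ^ wt (x + c) - T ^ wt (y + c)"
      using x y by (cases "c = 0") simp_all
  qed
  then have "T ^ Suc m dvd (1 - T) ^ (2 * k + 2) * (\<Sum>i\<le>m. of_int (E i) * (P ^ (m - i) * Q ^ i))"
    unfolding D[symmetric] by (rule dvd_mult)
  \<comment> \<open>The cofactor of \<open>T\<close> has constant term -8, so \<open>Q - P\<close>
    vanishes at the origin to order exactly one.\<close>
  moreover have "Q - P = T * (- 8 - 8 * T)"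
    by (simp add: P_def Q_def power2_eq_square algebra_simps)
  ultimately have "E i = 0" if "i \<le> m" for i
    by (rule binary_form_eq_0[folded T_def]) (use that in \<open>simp_all add: Q_def T_def\<close>)
  then have "of_nat (card C) * D = 0"
    unfolding D by simp
  moreover have "card C \<noteq> 0"
    using \<open>0 \<in> C\<close> by auto
  ultimately have "(\<Sum>c\<in>C. T ^ wt (x + c)) = (\<Sum>c\<in>C. T ^ wt (y + c))"
    by (simp add: D_def)
  then have "coeff (\<Sum>c\<in>C. T ^ wt (x + c)) d = coeff (\<Sum>c\<in>C. T ^ wt (y + c)) d"
    by simp
  then show ?thesis
    unfolding T_def by (simp only: coeff_sum_powers finite of_nat_eq_iff)
qed

theorem theorem17:
  fixes C :: "(klein ^ 'n) set" and k :: nat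
  assumes "CARD('n) = 6 * k"
    and "linear_code C" and "even_code C" and "self_dual C" and "extremal C"
  shows "\<forall>w\<ge>1. (\<exists>x\<in>C. wt x = w) \<longrightarrow>
           (\<exists>\<mu>. generalized_design 2 w \<mu> {x \<in> C. wt x = w})"
proof (intro allI impI)
  fix w :: nat
  assume w: "\<exists>x\<in>C. wt x = w"
  have min: "2 * k + 2 \<le> wt c" if "c \<in> C" "c \<noteq> 0" for c
  proof -
    have "Min (wt ` (C - {0})) \<le> wt c"
      using that by (intro Min_le) auto
    then show ?thesis
      using assms(1,5) by (simp add: extremal_def minimal_weight_def)
  qed
  have "\<exists>\<kappa>. \<forall>x\<in>weight_shell 2. card {c \<in> C. wt (x + c) = d} = \<kappa>" for d
  \<comment> \<open>Any vector of weight 2 serves as reference; without one the claim is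
    vacuous.\<close>
  proof (cases "\<exists>y. y \<in> (weight_shell 2 :: (klein ^ 'n) set)")
    case True
    then obtain y :: "klein ^ 'n" where y: "y \<in> weight_shell 2" ..
    have "\<forall>x\<in>weight_shell 2. card {c \<in> C. wt (x + c) = d} = card {c \<in> C. wt (y + c) = d}"
      by (intro ballI coset_distribution_weight_2[OF assms(1-4) min _ y])
    then show ?thesis ..
  qed simp
  moreover have "\<forall>c\<in>C. wt c \<noteq> 1"
    using assms(3) by (auto simp: even_code_def)
  ultimately obtain \<mu> where
    "\<forall>x\<in>weight_shell 2. card {c \<in> {c \<in> C. wt c = w}. covered_by x c} = \<mu>"
    using shells_cover_regularly by blast
  then have "generalized_design 2 w \<mu> {x \<in> C. wt x = w}"
    using w by (auto simp: generalized_design_def weight_shell_def)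
  then show "\<exists>\<mu>. generalized_design 2 w \<mu> {x \<in> C. wt x = w}" ..
qed

end
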